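(* There exist probability spaces $(\Omega_1,\mathcal{F}_1,\mathbb{P}_1)$ and $(\Omega_2,\mathcal{F}_2,\mathbb{P}_2)$ and uniformly distributed random variables $X:\Omega_1\to[0,1]$ and $Y:\Omega_2\to[0,1]$ such that $X(\Omega_1)\cap Y(\Omega_2)=\emptyset$.
   Context: $\mathcal{B}[0,1]$ denotes the Borel $\sigma$-algebra on $[0,1]$ and $\lambda$ denotes Lebesgue measure on $[0,1]$ restricted to Borel sets. A random variable $X:\Omega\to[0,1]$ on a probability space $(\Omega,\mathcal{F},\mathbb{P})$, i.e. a function measurable from $\mathcal{F}$ to $\mathcal{B}[0,1]$, is called uniformly distributed if $\mathbb{P}(X^{-1}(A))=\lambda(A)$ for all $A\in\mathcal{B}[0,1]$. Random variables may be defined on different probability spaces. $X(\Omega)$ denotes the image (range) of the function $X$. *)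

theory Defs
  imports "HOL-Probability.Probability"
begin

text \<open>
  Random variables are Isabelle functions, total on the type; only their values on
  \<open>space M\<close> are relevant.
\<close>

definition uniformly_distributed :: "'a measure \<Rightarrow> ('a \<Rightarrow> real) \<Rightarrow> bool" where
  "uniformly_distributed M X \<longleftrightarrow>
     X \<in> M \<rightarrow>\<^sub>M restrict_space borel {0..1} \<and>
     (\<forall>A \<in> sets (restrict_space borel {0..1}).
        emeasure M (X -` A \<inter> space M) = emeasure (restrict_space lborel {0..1}) A)"

end

theory Submission
  imports Defs
begin

text \<open>
  It suffices to find a set \<open>E\<close> of reals such that every Borel set contained in \<open>E\<close>, and every
  Borel set disjoint from \<open>E\<close>, is a Lebesgue null set. The two traces of \<open>E\<close> and of its complement
  on the unit interval are then disjoint and both have full outer measure. A set \<open>S\<close> of full outer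
  measure, measurable or not, carries the trace measure that gives \<open>S \<inter> A\<close> the mass of \<open>A\<close>
  (lemma \<open>ex_trace_measure\<close>); the inclusion of \<open>S\<close> into the unit interval is uniformly distributed
  for this measure, and its range is \<open>S\<close>.

  The set \<open>E\<close> is of Vitali type. The triadic rationals \<open>a / 3 ^ n\<close> form a group in which those with
  even numerator form a subgroup of index two, whose other coset contains all the numbers
  \<open>1 / 3 ^ n\<close>. Choosing a representative of each coset of the triadic rationals and letting \<open>E\<close>
  consist of the reals at an even distance from their representative, one obtains a set that every
  translation by \<open>1 / 3 ^ n\<close> exchanges with its complement (lemma \<open>ex_triadic_alternating_set\<close>).
  By the theorem of Steinhaus, the differences of the elements of a set of positive measure include
  \<open>1 / 3 ^ n\<close> for large \<open>n\<close>, so such a set is contained neither in \<open>E\<close> nor in its complement.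
\<close>

section \<open>The trace of a measure on a set of full outer measure\<close>

text \<open>The set \<open>S\<close> has full outer measure: a measurable set that misses \<open>S\<close> is a null set.\<close>

definition thick :: "'a measure \<Rightarrow> 'a set \<Rightarrow> bool" where
  "thick M S \<longleftrightarrow> S \<subseteq> space M \<and> (\<forall>A\<in>sets M. S \<inter> A = {} \<longrightarrow> A \<in> null_sets M)"

lemma thick_null: "thick M S \<Longrightarrow> A \<in> sets M \<Longrightarrow> S \<inter> A = {} \<Longrightarrow> A \<in> null_sets M"
  by (simp add: thick_def)

lemma outer_measure_of_thick_Int:
  assumes S: "thick M S" and A: "A \<in> sets M"
  shows "outer_measure_of M (S \<inter> A) = emeasure M A"
proof (rule antisym)
  show "outer_measure_of M (S \<inter> A) \<le> emeasure M A"
    using outer_measure_of_mono[of "S \<inter> A" A M] A by simp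
  show "emeasure M A \<le> outer_measure_of M (S \<inter> A)"
    unfolding outer_measure_of_def
  proof (rule INF_greatest)
    fix B assume "B \<in> {B \<in> sets M. S \<inter> A \<subseteq> B}"
    then have B: "B \<in> sets M" "S \<inter> A \<subseteq> B" by auto
    then have "A - B \<in> null_sets M"
      using A by (intro thick_null[OF S]) auto
    then have "emeasure M B = emeasure M (B \<union> (A - B))"
      using B by (intro emeasure_Un_null_set[symmetric])
    also have "\<dots> \<ge> emeasure M A"
      using A B by (intro emeasure_mono) auto
    finally show "emeasure M A \<le> emeasure M B" .
  qed
qed

text \<open>
  On the trace of the \<open>\<sigma>\<close>-algebra, the outer measure is countably additive, although \<open>S\<close> itself
  need not be measurable.
\<close>

lemma ex_trace_measure:
  assumes S: "thick M S"
  shows "\<exists>N. space N = S \<and> sets N = (\<inter>) S ` sets M \<and>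
    (\<forall>A\<in>sets M. emeasure N (S \<inter> A) = emeasure M A)"
proof -
  let ?\<Sigma> = "(\<inter>) S ` sets M"
  define N where "N = measure_of S ?\<Sigma> (outer_measure_of M)"
  have sub: "S \<subseteq> space M" using S by (simp add: thick_def)
  have restr: "space (restrict_space M S) = S" "sets (restrict_space M S) = ?\<Sigma>"
    using sub by (auto simp: space_restrict_space sets_restrict_space)
  then have alg: "sigma_algebra S ?\<Sigma>"
    using sets.sigma_algebra_axioms[of "restrict_space M S"] by simp
  then have sets_N: "sets N = ?\<Sigma>" and space_N: "space N = S"
    unfolding N_def
    by (auto simp: sigma_algebra.sets_measure_of_eq sigma_algebra.space_measure_of_eq)
  have emeasure_N: "emeasure N (S \<inter> A) = emeasure M A" if A: "A \<in> sets M" for A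
  proof -
    have "emeasure N (S \<inter> A) = outer_measure_of M (S \<inter> A)"
    proof (rule emeasure_measure_of_sigma[OF alg, of "outer_measure_of M", folded N_def])
      show "positive ?\<Sigma> (outer_measure_of M)"
        by (simp add: positive_def)
      show "countably_additive ?\<Sigma> (outer_measure_of M)"
      proof (rule countably_additiveI)
        fix B :: "nat \<Rightarrow> 'a set"
        assume B: "range B \<subseteq> ?\<Sigma>" and disj: "disjoint_family B"
        have "\<forall>i. \<exists>A\<in>sets M. B i = S \<inter> A" using B by auto
        then obtain A where A: "\<And>i. A i \<in> sets M" "\<And>i. B i = S \<inter> A i" by metis
        \<comment> \<open>The sets \<open>A i\<close> may overlap off \<open>S\<close>; making them disjoint does not change their traces.\<close>
        define D where "D = disjointed A"
        have D: "range D \<subseteq> sets M" "disjoint_family D"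
          unfolding D_def using A(1)
          by (auto intro!: sets.range_disjointed_sets disjoint_family_disjointed
              simp del: image_subset_iff)
        have BD: "B i = S \<inter> D i" for i
        proof -
          have "B i \<inter> B j = {}" if "j < i" for j
            using disj that by (auto simp: disjoint_family_on_def)
          then show ?thesis
            unfolding D_def disjointed_def A(2) by fastforce
        qed
        have "(\<Sum>i. outer_measure_of M (B i)) = (\<Sum>i. emeasure M (D i))"
          using D(1) by (auto simp: BD outer_measure_of_thick_Int[OF S] intro!: suminf_cong)
        also have "\<dots> = emeasure M (\<Union>i. D i)"
          using D by (rule suminf_emeasure)
        also have "\<dots> = outer_measure_of M (S \<inter> (\<Union>i. D i))"
          using D(1) by (subst outer_measure_of_thick_Int[OF S]) auto
        also have "S \<inter> (\<Union>i. D i) = (\<Union>i. B i)"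
          by (auto simp: BD)
        finally show "(\<Sum>i. outer_measure_of M (B i)) = outer_measure_of M (\<Union>i. B i)" .
      qed
      show "S \<inter> A \<in> ?\<Sigma>" using A by auto
    qed
    then show ?thesis by (simp add: outer_measure_of_thick_Int[OF S A])
  qed
  show ?thesis using sets_N space_N emeasure_N by blast
qed

lemma ex_uniformly_distributed_onto_thick:
  assumes S: "thick (restrict_space lborel {0..1}) S"
  shows "\<exists>N. prob_space N \<and> uniformly_distributed N (\<lambda>x. x) \<and> (\<lambda>x. x) ` space N = S"
proof -
  let ?L = "restrict_space lborel {0..1::real}"
  have sub: "S \<subseteq> {0..1}"
    using S by (simp add: thick_def space_restrict_space)
  have sets_L: "sets (restrict_space borel {0..1::real}) = sets ?L"
    by (simp add: sets_restrict_space)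
  obtain N where N: "space N = S" "sets N = (\<inter>) S ` sets ?L"
    and em: "\<And>A. A \<in> sets ?L \<Longrightarrow> emeasure N (S \<inter> A) = emeasure ?L A"
    using ex_trace_measure[OF S] by metis
  have "emeasure N (space N) = emeasure ?L {0..1}"
    using em[of "space ?L"] sub N(1) sets.top[of ?L]
    by (simp add: space_restrict_space Int_absorb2)
  also have "\<dots> = 1"
    by (simp add: emeasure_restrict_space)
  finally have "prob_space N" by (rule prob_spaceI)
  moreover have "uniformly_distributed N (\<lambda>x. x)"
    unfolding uniformly_distributed_def
  proof (intro conjI ballI)
    show "(\<lambda>x. x) \<in> N \<rightarrow>\<^sub>M restrict_space borel {0..1}"
    proof (rule measurableI)
      show "x \<in> space (restrict_space borel {0..1})" if "x \<in> space N" for x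
        using that sub N(1) by (auto simp: space_restrict_space)
      show "(\<lambda>x. x) -` A \<inter> space N \<in> sets N"
        if "A \<in> sets (restrict_space borel {0..1})" for A
        using that unfolding N sets_L by (auto simp: Int_commute)
    qed
    show "emeasure N ((\<lambda>x. x) -` A \<inter> space N) = emeasure ?L A"
      if "A \<in> sets (restrict_space borel {0..1})" for A
      using em[of A] that unfolding N(1) sets_L by (simp add: Int_commute)
  qed
  ultimately show ?thesis using N(1) by auto
qed

section \<open>The theorem of Steinhaus\<close>

text \<open>
  An open set \<open>U\<close> around \<open>T\<close> of measure less than twice that of \<open>T\<close> has no room for two disjoint
  translates of \<open>T\<close>, but it contains all small translates of \<open>T\<close>.
\<close>

lemma steinhaus_compact:
  fixes T :: "'a::euclidean_space set"
  assumes T: "compact T" and pos: "measure lebesgue T > 0"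
  shows "\<exists>\<epsilon>>0. \<forall>h. norm h < \<epsilon> \<longrightarrow> (\<exists>x\<in>T. x + h \<in> T)"
proof -
  let ?m = "measure lebesgue T"
  have Tm: "T \<in> lmeasurable" using T by (rule lmeasurable_compact)
  then obtain U where U: "open U" "T \<subseteq> U" and UT: "U - T \<in> lmeasurable"
    and small: "emeasure lebesgue (U - T) < ennreal ?m"
    using sets_lebesgue_outer_open[OF _ pos, of T] by (metis fmeasurableD)
  have eqU: "U = T \<union> (U - T)" using U(2) by auto
  have Um: "U \<in> lmeasurable" using fmeasurable.Un[OF Tm UT] eqU by simp
  have "measure lebesgue (U - T) < ?m"
    using small UT pos by (simp add: emeasure_eq_measure2 ennreal_less_iff)
  moreover have "measure lebesgue U \<le> ?m + measure lebesgue (U - T)"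
    using eqU measure_Un_le[of T lebesgue "U - T"] Tm UT by (metis fmeasurableD)
  ultimately have less: "measure lebesgue U < 2 * ?m" by simp
  obtain \<epsilon> where \<epsilon>: "\<epsilon> > 0" "(\<Union>x\<in>T. ball x \<epsilon>) \<subseteq> U"
    using compact_subset_open_imp_ball_epsilon_subset[OF T U] .
  have "\<exists>x\<in>T. x + h \<in> T" if h: "norm h < \<epsilon>" for h
  proof (rule ccontr)
    assume "\<not> ?thesis"
    then have disj: "T \<inter> (+) h ` T = {}" by (auto simp: add.commute)
    have "x + h \<in> U" if "x \<in> T" for x
      using \<epsilon>(2) that h by (force simp: dist_norm)
    then have "T \<union> (+) h ` T \<subseteq> U" using U(2) by (auto simp: add.commute)
    moreover have hT: "(+) h ` T \<in> lmeasurable" using Tm by (rule measurable_translation)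
    ultimately have "measure lebesgue (T \<union> (+) h ` T) \<le> measure lebesgue U"
      using Tm Um by (intro measure_mono_fmeasurable) auto
    moreover have "measure lebesgue (T \<union> (+) h ` T) = ?m + measure lebesgue ((+) h ` T)"
      using Tm hT disj by (intro measure_Un2[THEN trans]) (auto simp: Diff_triv Int_commute)
    ultimately show False using less by (simp add: measure_translation)
  qed
  then show ?thesis using \<epsilon>(1) by blast
qed

text \<open>Inner regularity reduces the general case to that of a compact set.\<close>

lemma steinhaus:
  fixes S :: "'a::euclidean_space set"
  assumes S: "S \<in> sets lebesgue" and pos: "\<not> negligible S"
  shows "\<exists>\<epsilon>>0. \<forall>h. norm h < \<epsilon> \<longrightarrow> (\<exists>x\<in>S. x + h \<in> S)"
proof -
  have "S = (\<Union>n. S \<inter> cball 0 (real n))"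
    by (auto simp: real_arch_simple)
  then obtain n where n: "\<not> negligible (S \<inter> cball 0 (real n))"
    using pos negligible_Union_nat[of "\<lambda>n. S \<inter> cball 0 (real n)"] by metis
  define B where "B = S \<inter> cball 0 (real n)"
  have Bm: "B \<in> lmeasurable"
    unfolding B_def using S by (intro bounded_set_imp_lmeasurable) auto
  have Bpos: "measure lebesgue B > 0"
    using n Bm by (simp add: B_def negligible_iff_measure zero_less_measure_iff)
  obtain T where T: "closed T" "T \<subseteq> B" and BT: "B - T \<in> lmeasurable"
    and small: "emeasure lebesgue (B - T) < ennreal (measure lebesgue B)"
    using sets_lebesgue_inner_closed[OF fmeasurableD[OF Bm] Bpos] by metis
  have "compact T"
    using T by (auto simp: compact_eq_bounded_closed B_def intro: bounded_subset[OF bounded_cball])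
  moreover have "measure lebesgue T > 0"
  proof -
    have "measure lebesgue (B - T) < measure lebesgue B"
      using small BT Bpos by (simp add: emeasure_eq_measure2 ennreal_less_iff)
    moreover have "measure lebesgue (B - T) = measure lebesgue B - measure lebesgue T"
      using T Bm lmeasurable_compact[OF \<open>compact T\<close>]
      by (intro measurable_measure_Diff) auto
    ultimately show ?thesis by simp
  qed
  ultimately show ?thesis
    using steinhaus_compact[of T] T(2) unfolding B_def by blast
qed

section \<open>A set exchanged with its complement by small translations\<close>

text \<open>The additive group of the rationals whose denominator is a power of three.\<close>

definition triadic :: "real set" where
  "triadic = {of_int a / 3 ^ n |a n. True}"

text \<open>
  The subgroup of index two of the triadic rationals with even numerator. As powers of three are
  odd, the parity of the numerator does not depend on the fraction chosen.
\<close>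

definition even_triadic :: "real set" where
  "even_triadic = {of_int (2 * a) / 3 ^ n |a n. True}"

lemma triadicI: "x * 3 ^ n = of_int a \<Longrightarrow> x \<in> triadic"
  unfolding triadic_def by (auto simp: field_simps)

lemma triadicE:
  assumes "x \<in> triadic" obtains a n where "x * 3 ^ n = of_int a"
  using assms unfolding triadic_def by (auto simp: field_simps)

lemma even_triadicI: "x * 3 ^ n = of_int a \<Longrightarrow> even a \<Longrightarrow> x \<in> even_triadic"
  unfolding even_triadic_def by (force simp: field_simps elim!: evenE)

lemma even_triadicE:
  assumes "x \<in> even_triadic" obtains a n where "x * 3 ^ n = of_int a" "even a"
proof -
  from assms obtain b n where "x = of_int (2 * b) / 3 ^ n"
    unfolding even_triadic_def by blast
  then have "x * 3 ^ n = of_int (2 * b)" by simp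
  then show ?thesis using that by (metis dvd_triv_left)
qed

lemma triadic_diff: "x \<in> triadic \<Longrightarrow> y \<in> triadic \<Longrightarrow> x - y \<in> triadic"
proof (elim triadicE)
  fix a b m n assume "x * 3 ^ m = of_int a" "y * 3 ^ n = of_int b"
  moreover have "(x - y) * 3 ^ (m + n) = (x * 3 ^ m) * 3 ^ n - (y * 3 ^ n) * 3 ^ m"
    by (simp add: power_add algebra_simps)
  ultimately have "(x - y) * 3 ^ (m + n) = of_int (a * 3 ^ n - b * 3 ^ m)"
    by simp
  then show ?thesis by (rule triadicI)
qed

lemma triadic_uminus: "x \<in> triadic \<Longrightarrow> - x \<in> triadic"
  using triadic_diff[OF triadic_diff, of x x x] by simp

lemma triadic_add: "x \<in> triadic \<Longrightarrow> y \<in> triadic \<Longrightarrow> x + y \<in> triadic"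
  using triadic_diff[of x "- y"] triadic_uminus[of y] by simp

lemma triadic_inverse_power: "1 / 3 ^ n \<in> triadic"
  by (rule triadicI[of _ n 1]) simp

lemma even_triadic_shift:
  assumes x: "x \<in> triadic"
  shows "x + 1 / 3 ^ n \<in> even_triadic \<longleftrightarrow> x \<notin> even_triadic"
proof
  assume "x \<notin> even_triadic"
  obtain a m where am: "x * 3 ^ m = of_int a" using x by (rule triadicE)
  with \<open>x \<notin> even_triadic\<close> have "odd a" using even_triadicI by blast
  have "(x + 1 / 3 ^ n) * 3 ^ (m + n) = of_int (a * 3 ^ n + 3 ^ m)"
    using am by (simp add: power_add field_simps)
  then show "x + 1 / 3 ^ n \<in> even_triadic"
    by (rule even_triadicI) (use \<open>odd a\<close> in simp)
next
  assume "x + 1 / 3 ^ n \<in> even_triadic"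
  then obtain b k where bk: "(x + 1 / 3 ^ n) * 3 ^ k = of_int b" "even b"
    by (rule even_triadicE)
  show "x \<notin> even_triadic"
  proof
    assume "x \<in> even_triadic"
    then obtain a m where am: "x * 3 ^ m = of_int a" "even a" by (rule even_triadicE)
    \<comment> \<open>Clearing denominators would make a power of three even.\<close>
    have "of_int (b * 3 ^ m * 3 ^ n) = (x + 1 / 3 ^ n) * 3 ^ k * 3 ^ m * 3 ^ n"
      using bk by simp
    also have "\<dots> = (x * 3 ^ m) * 3 ^ k * 3 ^ n + 3 ^ (k + m)"
      by (simp add: power_add field_simps)
    also have "\<dots> = of_int (a * 3 ^ k * 3 ^ n + 3 ^ (k + m))"
      using am by simp
    finally have "b * 3 ^ m * 3 ^ n = a * 3 ^ k * 3 ^ n + 3 ^ (k + m)"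
      by (simp only: of_int_eq_iff)
    then have "even (a * 3 ^ k * 3 ^ n + 3 ^ (k + m))"
      using bk(2) by (metis dvd_mult2)
    then show False using am(2) by simp
  qed
qed

lemma ex_triadic_alternating_set:
  "\<exists>E :: real set. \<forall>x n. x + 1 / 3 ^ n \<in> E \<longleftrightarrow> x \<notin> E"
proof -
  \<comment> \<open>\<open>r x\<close> is the chosen representative of the coset of \<open>x\<close>.\<close>
  define r where "r x = (SOME y. x - y \<in> triadic)" for x
  have r: "x - r x \<in> triadic" for x
    unfolding r_def by (rule someI[of _ x]) (rule triadicI[of _ 0 0], simp)
  have r_shift: "r (x + 1 / 3 ^ n) = r x" for x n
  proof -
    have "x + 1 / 3 ^ n - y \<in> triadic \<longleftrightarrow> x - y \<in> triadic" for y
      using triadic_add[of "x - y" "1 / 3 ^ n"] triadic_diff[of "x + 1 / 3 ^ n - y" "1 / 3 ^ n"]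
        triadic_inverse_power[of n] by (auto simp: algebra_simps)
    then show ?thesis by (simp add: r_def)
  qed
  have "x + 1 / 3 ^ n - r (x + 1 / 3 ^ n) \<in> even_triadic \<longleftrightarrow> x - r x \<notin> even_triadic" for x n
    using even_triadic_shift[OF r, of x n] by (simp add: r_shift algebra_simps)
  then show ?thesis
    by (intro exI[of _ "{x. x - r x \<in> even_triadic}"]) simp
qed

lemma negligible_if_subset_alternating:
  fixes E :: "real set"
  assumes E: "\<And>x n. x + 1 / 3 ^ n \<in> E \<longleftrightarrow> x \<notin> E"
    and A: "A \<in> sets lebesgue" "A \<subseteq> E"
  shows "negligible A"
proof (rule ccontr)
  assume "\<not> negligible A"
  then obtain \<epsilon> where "\<epsilon> > 0" and \<epsilon>: "\<And>h. norm h < \<epsilon> \<Longrightarrow> \<exists>x\<in>A. x + h \<in> A"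
    using steinhaus[OF A(1)] by blast
  obtain n where "(1 / 3 :: real) ^ n < \<epsilon>"
    using real_arch_pow_inv[OF \<open>\<epsilon> > 0\<close>, of "1 / 3"] by auto
  then have "norm (1 / 3 ^ n :: real) < \<epsilon>" by (simp add: power_one_over)
  then obtain x where "x \<in> A" "x + 1 / 3 ^ n \<in> A" using \<epsilon> by blast
  then show False using E A(2) by blast
qed

lemma thick_alternating:
  fixes E :: "real set"
  assumes E: "\<And>x n. x + 1 / 3 ^ n \<in> E \<longleftrightarrow> x \<notin> E"
  shows "thick (restrict_space lborel {0..1}) ({0..1} \<inter> E)"
  unfolding thick_def
proof (intro conjI ballI impI)
  show "{0..1} \<inter> E \<subseteq> space (restrict_space lborel {0..1})"
    by (simp add: space_restrict_space)
  fix A assume A: "A \<in> sets (restrict_space lborel {0..1::real})" and "{0..1} \<inter> E \<inter> A = {}"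
  then have A': "A \<in> sets borel" "A \<subseteq> {0..1}" "A \<subseteq> - E"
    by (auto simp: sets_restrict_space)
  \<comment> \<open>The complement of \<open>E\<close> has the same alternating property as \<open>E\<close>.\<close>
  have "negligible A"
    by (rule negligible_if_subset_alternating[of "- E"]) (use E A' in auto)
  then have "A \<in> null_sets lborel"
    using A'(1) by (auto simp: negligible_iff_null_sets null_sets_def)
  then show "A \<in> null_sets (restrict_space lborel {0..1})"
    using A A'(2) by (simp add: null_sets_restrict_space)
qed

section \<open>Uniform random variables with disjoint ranges\<close>

theorem theorem3:
  shows "\<exists>(M1 :: real measure) (M2 :: real measure) (X :: real \<Rightarrow> real) (Y :: real \<Rightarrow> real).
    prob_space M1 \<and> prob_space M2 \<and>
    uniformly_distributed M1 X \<and> uniformly_distributed M2 Y \<and>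
    X ` space M1 \<inter> Y ` space M2 = {}"
proof -
  obtain E :: "real set" where E: "\<And>x n. x + 1 / 3 ^ n \<in> E \<longleftrightarrow> x \<notin> E"
    using ex_triadic_alternating_set by blast
  obtain M1 where M1: "prob_space M1" "uniformly_distributed M1 (\<lambda>x. x)"
    "(\<lambda>x. x) ` space M1 = {0..1} \<inter> E"
    using ex_uniformly_distributed_onto_thick[OF thick_alternating[of E]] E by blast
  obtain M2 where M2: "prob_space M2" "uniformly_distributed M2 (\<lambda>x. x)"
    "(\<lambda>x. x) ` space M2 = {0..1} \<inter> - E"
    using ex_uniformly_distributed_onto_thick[OF thick_alternating[of "- E"]] E by blast
  have "(\<lambda>x. x) ` space M1 \<inter> (\<lambda>x. x) ` space M2 = {}"
    unfolding M1(3) M2(3) by blast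
  then show ?thesis using M1(1,2) M2(1,2) by blast
qed

end
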